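(* Let $R=k[x_1,\ldots,x_d]$ be a polynomial ring over a field $k$ and let $I$ be a monomial ideal of $R$ minimally generated by the monomials $x^{v_1},\ldots,x^{v_q}$, where $v_1,\ldots,v_q\in\mathbb{N}^d$. Let $r_0$ be the rank of the matrix $(v_1,\ldots,v_q)$. If $v_1,\ldots,v_q$ lie in a hyperplane of $\mathbb{R}^d$ not containing the origin, then $\overline{I^b}=I\,\overline{I^{b-1}}$ for all integers $b\geq r_0$.
   Context: $\mathbb{N}$ denotes the non-negative integers. For $a=(a_1,\ldots,a_d)\in\mathbb{N}^d$, $x^a=x_1^{a_1}\cdots x_d^{a_d}$. For an ideal $J$ of $R$, $\overline{J}$ denotes its integral closure in $R$; by convention $I^0=R$. A hyperplane here is an affine hyperplane. The matrix $(v_1,\ldots,v_q)$ is the matrix whose columns are the vectors $v_i$. *)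

theory Defs
  imports "HOL-Analysis.Analysis" "HOL-Library.Poly_Mapping"
begin

section \<open>Ideals in a commutative ring\<close>

lemma ring_module: "module ((*) :: 'a::comm_ring_1 \<Rightarrow> 'a \<Rightarrow> 'a)"
  by unfold_locales (simp_all add: algebra_simps)

text \<open>The ring is viewed as a module over itself, so that the library's submodules are the ideals
  and its linear span is the ideal generated by a set.\<close>

definition ideal_gen :: "'a::comm_ring_1 set \<Rightarrow> 'a set"
  where "ideal_gen S = module.span (*) S"

definition ideal_mult :: "'a::comm_ring_1 set \<Rightarrow> 'a set \<Rightarrow> 'a set"
  where "ideal_mult I J = ideal_gen {a * b | a b. a \<in> I \<and> b \<in> J}"

primrec ideal_power :: "'a::comm_ring_1 set \<Rightarrow> nat \<Rightarrow> 'a set"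
  where
    "ideal_power I 0 = UNIV"
  | "ideal_power I (Suc n) = ideal_mult I (ideal_power I n)"

text \<open>An element \<open>f\<close> is integral over \<open>J\<close> if it satisfies an equation
  \<open>f\<^sup>n + c\<^sub>1 f\<^sup>n\<^sup>-\<^sup>1 + \<dots> + c\<^sub>n = 0\<close> with \<open>n \<ge> 1\<close> and every \<open>c\<^sub>i\<close> in the power \<open>J\<^sup>i\<close>.\<close>

definition integral_closure :: "'a::comm_ring_1 set \<Rightarrow> 'a set"
  where "integral_closure J =
    {f. \<exists>n\<ge>1. \<exists>c. (\<forall>i\<in>{1..n}. c i \<in> ideal_power J i) \<and>
          f ^ n + (\<Sum>i=1..n. c i * f ^ (n - i)) = 0}"

text \<open>Omitting a single member suffices, because the generated ideal is monotone in the generators. The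
  condition also makes the family injective.\<close>

definition minimally_generates :: "('q \<Rightarrow> 'a::comm_ring_1) \<Rightarrow> 'a set \<Rightarrow> bool"
  where "minimally_generates g I \<longleftrightarrow>
    I = ideal_gen (range g) \<and> (\<forall>j. ideal_gen (g ` (UNIV - {j})) \<noteq> I)"


section \<open>Monomials in a polynomial ring\<close>

text \<open>A polynomial with variables indexed by \<open>'d\<close> is a finitely supported function from exponents
  to coefficients, with convolution as product; \<open>d\<close> is \<open>CARD('d)\<close>.\<close>

type_synonym ('d, 'k) polyring = "('d \<Rightarrow>\<^sub>0 nat) \<Rightarrow>\<^sub>0 'k"

definition variable :: "'d \<Rightarrow> ('d, 'k::field) polyring"
  where "variable i = Poly_Mapping.single (Poly_Mapping.single i 1) 1"

definition xpow :: "nat ^ 'd \<Rightarrow> ('d::finite, 'k::field) polyring"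
  where "xpow a = (\<Prod>i\<in>UNIV. variable i ^ (a $ i))"


section \<open>Exponent vectors as real vectors\<close>

definition real_vec :: "nat ^ 'd \<Rightarrow> real ^ 'd"
  where "real_vec a = (\<chi> i. real (a $ i))"

definition exponent_matrix :: "('q \<Rightarrow> nat ^ 'd) \<Rightarrow> real ^ 'q ^ 'd"
  where "exponent_matrix v = (\<chi> i j. real (v j $ i))"

definition hyperplane :: "(real ^ 'd::finite) set \<Rightarrow> bool"
  where "hyperplane H \<longleftrightarrow> (\<exists>a c. a \<noteq> 0 \<and> H = {x. a \<bullet> x = c})"

end

theory Submission
  imports Defs "Jordan_Normal_Form.Determinant"
begin

text \<open>The integral closure of a power of a monomial ideal is governed by a polyhedron. Let \<open>S\<close> be the
  set of exponent vectors of the generators of \<open>I\<close>, and let \<open>P\<close> be the Newton polyhedron, the sum of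
  the convex hull of \<open>S\<close> and the nonnegative orthant. Then the closure of \<open>I\<^sup>n\<close> consists of the
  polynomials all of whose exponents lie in \<open>n P\<close> (\<open>integral_closure_monomial_power\<close>). Given this
  description, the theorem says that for every lattice point \<open>u\<close> of \<open>b P\<close> some generator exponent
  \<open>s\<close> satisfies \<open>u - s \<in> (b - 1) P\<close>.

  Such an \<open>s\<close> is found by Caratheodory's theorem (\<open>newton_dilate_peel\<close>). Below \<open>u\<close> there is a point
  \<open>b p\<close> with \<open>p\<close> in the convex hull of \<open>S\<close>, and \<open>p\<close> is a convex combination of at most
  \<open>aff_dim S + 1\<close> points of \<open>S\<close>. If \<open>b\<close> is at least this number, then after multiplication by \<open>b\<close> the
  coefficients sum to \<open>b\<close> and there are at most \<open>b\<close> of them, so one of them is at least \<open>1\<close>; the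
  corresponding point can be subtracted once. Because \<open>S\<close> lies in a hyperplane that misses the
  origin, \<open>aff_dim S + 1\<close> is the linear dimension of \<open>S\<close>, which is the rank of the exponent matrix.

  For the description of the closure, one inclusion uses supporting functionals. A point outside
  \<open>n P\<close> is separated from it by a functional \<open>y\<close> with nonnegative coordinates, and the minimal
  \<open>y\<close>-weight of the exponents of a polynomial behaves like a valuation, which an equation of integral
  dependence cannot violate (\<open>integral_closure_subset_order_ideal\<close>). For the other inclusion, let
  \<open>M\<close> be the ideal spanned by the monomials with exponent in \<open>T P\<close> for a large \<open>T\<close>. It is finitely
  generated, and peeling off generators gives \<open>f M \<subseteq> I\<^sup>n M\<close> for every \<open>f\<close> whose exponents lie in
  \<open>n P\<close>. The determinant trick (\<open>integral_if_stabilises_finite_module\<close>) then makes \<open>f\<close> integral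
  over \<open>I\<^sup>n\<close>. The peeling argument thus serves twice, and the detour through rational convex
  combinations and pure powers of monomials, as well as a separate proof that integral closures are
  closed under addition, is avoided.\<close>

section \<open>Ideals and the determinant trick\<close>

abbreviation is_ideal :: "'a::comm_ring_1 set \<Rightarrow> bool"
  where "is_ideal \<equiv> module.subspace (*)"

lemma is_ideal_iff:
  "is_ideal J \<longleftrightarrow> 0 \<in> J \<and> (\<forall>x\<in>J. \<forall>y\<in>J. x + y \<in> J) \<and> (\<forall>r. \<forall>x\<in>J. r * x \<in> J)"
  by (simp add: module.subspace_def[OF ring_module])

lemma is_ideal_ideal_gen: "is_ideal (ideal_gen S)"
  unfolding ideal_gen_def by (rule module.subspace_span[OF ring_module])

lemma ideal_gen_superset: "S \<subseteq> ideal_gen S"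
  unfolding ideal_gen_def by (rule module.span_superset[OF ring_module])

lemma ideal_gen_least: "S \<subseteq> J \<Longrightarrow> is_ideal J \<Longrightarrow> ideal_gen S \<subseteq> J"
  unfolding ideal_gen_def by (rule module.span_minimal[OF ring_module])

lemmas is_ideal_0 = module.subspace_0[OF ring_module]
  and is_ideal_add = module.subspace_add[OF ring_module]
  and is_ideal_scale = module.subspace_scale[OF ring_module]
  and is_ideal_neg = module.subspace_neg[OF ring_module]

lemma is_ideal_sum: "is_ideal J \<Longrightarrow> (\<And>i. i \<in> A \<Longrightarrow> g i \<in> J) \<Longrightarrow> sum g A \<in> J"
  by (rule module.subspace_sum[OF ring_module])

lemma is_ideal_ideal_mult: "is_ideal (ideal_mult I J)"
  unfolding ideal_mult_def by (rule is_ideal_ideal_gen)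

lemma ideal_mult_memI: "a \<in> I \<Longrightarrow> b \<in> J \<Longrightarrow> a * b \<in> ideal_mult I J"
  unfolding ideal_mult_def by (rule subsetD[OF ideal_gen_superset]) blast

lemma ideal_mult_least:
  assumes "is_ideal K" and "\<And>a b. a \<in> I \<Longrightarrow> b \<in> J \<Longrightarrow> a * b \<in> K"
  shows "ideal_mult I J \<subseteq> K"
  unfolding ideal_mult_def using assms by (intro ideal_gen_least) auto

lemma is_ideal_ideal_power: "is_ideal (ideal_power J n)"
  by (cases n) (simp_all add: is_ideal_ideal_mult module.subspace_UNIV[OF ring_module])

text \<open>Allowing a different coefficient set \<open>J i\<close> for each \<open>m i\<close> covers two situations. With the power
  \<open>J\<^sup>i\<close> one obtains the non-leading parts of equations of integral dependence, and with a constant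
  ideal \<open>J\<close> the product of \<open>J\<close> with the module generated by the \<open>m i\<close>.\<close>

definition combinations :: "('i \<Rightarrow> 'a::comm_ring_1 set) \<Rightarrow> ('i \<Rightarrow> 'a) \<Rightarrow> 'i set \<Rightarrow> 'a set"
  where "combinations J m F = {t. \<exists>c. (\<forall>i\<in>F. c i \<in> J i) \<and> t = (\<Sum>i\<in>F. c i * m i)}"

lemma combinationsI:
  "(\<And>i. i \<in> F \<Longrightarrow> c i \<in> J i) \<Longrightarrow> t = (\<Sum>i\<in>F. c i * m i) \<Longrightarrow> t \<in> combinations J m F"
  unfolding combinations_def by (intro CollectI exI[of _ c]) simp

lemma combinationsE:
  assumes "t \<in> combinations J m F"
  obtains c where "\<forall>i\<in>F. c i \<in> J i" and "t = (\<Sum>i\<in>F. c i * m i)"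
  using assms unfolding combinations_def mem_Collect_eq by (elim exE conjE)

lemma is_ideal_combinations:
  assumes J: "\<And>i. is_ideal (J i)"
  shows "is_ideal (combinations J m F)"
  unfolding is_ideal_iff
proof (intro conjI ballI allI)
  show "0 \<in> combinations J m F"
    by (rule combinationsI[where c = "\<lambda>_. 0"]) (simp_all add: is_ideal_0[OF J])
next
  fix s t assume "s \<in> combinations J m F" "t \<in> combinations J m F"
  then obtain c d where "\<forall>i\<in>F. c i \<in> J i" "s = (\<Sum>i\<in>F. c i * m i)"
    "\<forall>i\<in>F. d i \<in> J i" "t = (\<Sum>i\<in>F. d i * m i)"
    by (elim combinationsE)
  then show "s + t \<in> combinations J m F"
    by (intro combinationsI[where c = "\<lambda>i. c i + d i"])
      (simp_all add: is_ideal_add[OF J] distrib_right sum.distrib)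
next
  fix r t assume "t \<in> combinations J m F"
  then obtain c where "\<forall>i\<in>F. c i \<in> J i" "t = (\<Sum>i\<in>F. c i * m i)"
    by (elim combinationsE)
  then show "r * t \<in> combinations J m F"
    by (intro combinationsI[where c = "\<lambda>i. r * c i"])
      (simp_all add: is_ideal_scale[OF J] sum_distrib_left mult.assoc)
qed

lemma combinations_member:
  assumes "\<And>i. is_ideal (J i)" and "finite F" and "k \<in> F" and "a \<in> J k"
  shows "a * m k \<in> combinations J m F"
proof (rule combinationsI[where c = "\<lambda>i. if i = k then a else 0"])
  have "(\<Sum>i\<in>F. (if i = k then a else 0) * m i) = (\<Sum>i\<in>F. if i = k then a * m k else 0)"
    by (intro sum.cong) auto
  then show "a * m k = (\<Sum>i\<in>F. (if i = k then a else 0) * m i)"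
    using assms(2,3) by simp
qed (use assms(1,4) in \<open>simp add: is_ideal_0\<close>)

abbreviation lower_terms :: "'a::comm_ring_1 set \<Rightarrow> 'a \<Rightarrow> nat \<Rightarrow> 'a set"
  where "lower_terms J f n \<equiv> combinations (ideal_power J) (\<lambda>i. f ^ (n - i)) {1..n}"

lemma integral_closure_iff_lower_terms:
  "f \<in> integral_closure J \<longleftrightarrow> (\<exists>n\<ge>1. \<exists>t\<in>lower_terms J f n. f ^ n + t = 0)"
proof
  assume "f \<in> integral_closure J"
  then obtain n c where "n \<ge> 1" "\<forall>i\<in>{1..n}. c i \<in> ideal_power J i"
    and eq: "f ^ n + (\<Sum>i=1..n. c i * f ^ (n - i)) = 0"
    unfolding integral_closure_def mem_Collect_eq by (elim exE conjE)
  then have "(\<Sum>i=1..n. c i * f ^ (n - i)) \<in> lower_terms J f n"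
    by (intro combinationsI[where c = c]) simp_all
  with \<open>n \<ge> 1\<close> eq show "\<exists>n\<ge>1. \<exists>t\<in>lower_terms J f n. f ^ n + t = 0" by blast
next
  assume "\<exists>n\<ge>1. \<exists>t\<in>lower_terms J f n. f ^ n + t = 0"
  then obtain n t where n: "n \<ge> 1" and t: "t \<in> lower_terms J f n" and eq: "f ^ n + t = 0" by blast
  obtain c where "\<forall>i\<in>{1..n}. c i \<in> ideal_power J i" "t = (\<Sum>i=1..n. c i * f ^ (n - i))"
    using t by (elim combinationsE)
  with n eq show "f \<in> integral_closure J"
    unfolding integral_closure_def mem_Collect_eq by (intro exI[of _ n] conjI exI[of _ c]) simp_all
qed

lemma is_ideal_lower_terms: "is_ideal (lower_terms J f n)"
  by (rule is_ideal_combinations[OF is_ideal_ideal_power])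

lemma lower_terms_times_self:
  assumes "t \<in> lower_terms J f n"
  shows "f * t \<in> lower_terms J f (Suc n)"
proof -
  obtain c where c: "\<forall>i\<in>{1..n}. c i \<in> ideal_power J i" and t: "t = (\<Sum>i=1..n. c i * f ^ (n - i))"
    using assms by (elim combinationsE)
  define d where "d i = (if i = Suc n then 0 else c i)" for i
  have "f * t = (\<Sum>i=1..n. d i * f ^ (Suc n - i))"
    unfolding t sum_distrib_left by (intro sum.cong) (auto simp: d_def Suc_diff_le algebra_simps)
  also have "\<dots> = (\<Sum>i=1..Suc n. d i * f ^ (Suc n - i))"
    by (simp add: d_def)
  finally have eq: "f * t = (\<Sum>i=1..Suc n. d i * f ^ (Suc n - i))" .
  have mem: "\<forall>i\<in>{1..Suc n}. d i \<in> ideal_power J i"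
    using c by (auto simp: d_def is_ideal_0[OF is_ideal_ideal_power] simp del: ideal_power.simps)
  show ?thesis by (rule combinationsI[where c = d]) (use mem eq in blast)+
qed

lemma lower_terms_times_ideal:
  assumes "t \<in> lower_terms J f n" and "a \<in> J"
  shows "a * t \<in> lower_terms J f (Suc n)"
proof -
  obtain c where c: "\<forall>i\<in>{1..n}. c i \<in> ideal_power J i" and t: "t = (\<Sum>i=1..n. c i * f ^ (n - i))"
    using assms by (elim combinationsE)
  define d where "d i = (if i = Suc 0 then 0 else a * c (i - 1))" for i
  have "a * t = (\<Sum>i=1..n. d (Suc i) * f ^ (Suc n - Suc i))"
    unfolding t sum_distrib_left by (intro sum.cong) (auto simp: d_def algebra_simps)
  also have "\<dots> = (\<Sum>i=Suc 1..Suc n. d i * f ^ (Suc n - i))"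
    by (simp only: sum.shift_bounds_cl_Suc_ivl)
  also have "\<dots> = (\<Sum>i=1..Suc n. d i * f ^ (Suc n - i))"
    using sum.atLeast_Suc_atMost[of 1 "Suc n" "\<lambda>i. d i * f ^ (Suc n - i)"] by (simp add: d_def del: sum.cl_ivl_Suc)
  finally have eq: "a * t = (\<Sum>i=1..Suc n. d i * f ^ (Suc n - i))" .
  have mem: "\<forall>i\<in>{1..Suc n}. d i \<in> ideal_power J i"
  proof
    fix i assume i: "i \<in> {1..Suc n}"
    show "d i \<in> ideal_power J i"
    proof (cases "i = 1")
      case True
      then show ?thesis by (simp add: d_def is_ideal_0[OF is_ideal_ideal_power] del: ideal_power.simps)
    next
      case False
      with i have "i - 1 \<in> {1..n}" by auto
      with c have "c (i - 1) \<in> ideal_power J (i - 1)" by blast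
      then have "a * c (i - 1) \<in> ideal_power J (Suc (i - 1))"
        using assms(2) by (simp add: ideal_mult_memI)
      moreover have "Suc (i - 1) = i" using i by simp
      ultimately show ?thesis using False by (simp add: d_def del: ideal_power.simps)
    qed
  qed
  show ?thesis by (rule combinationsI[where c = d]) (use mem eq in blast)+
qed

lemma ideal_times_power_in_lower_terms:
  assumes "a \<in> J"
  shows "a * f ^ n \<in> lower_terms J f (Suc n)"
proof -
  have "a * 1 \<in> ideal_power J (Suc 0)"
    using assms by (simp only: ideal_power.simps ideal_mult_memI UNIV_I)
  then show ?thesis
    using combinations_member[of "ideal_power J" "{1..Suc n}" 1 a "\<lambda>i. f ^ (Suc n - i)"]
    by (simp add: is_ideal_ideal_power del: ideal_power.simps)
qed

text \<open>This is the expansion of one term of a determinant whose entries are \<open>f\<close> (on the diagonal) or \<open>0\<close>,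
  up to elements of \<open>J\<close>: every factor taken from \<open>J\<close> raises the power of \<open>J\<close> by one and lowers the
  power of \<open>f\<close> by one, so only the product of all the \<open>f\<close> escapes the lower terms.\<close>

lemma prod_minus_leading_in_lower_terms:
  assumes "\<And>i. i < n \<Longrightarrow> a i \<in> J"
  shows "(\<Prod>i<n. (if d i then f else 0) - a i) - (if \<forall>i<n. d i then f ^ n else 0) \<in> lower_terms J f n"
  using assms
proof (induction n)
  case 0
  show ?case using is_ideal_lower_terms[of J f 0] by (simp add: is_ideal_iff)
next
  case (Suc n)
  define e where "e = (if \<forall>i<n. d i then f ^ n else 0)"
  define t where "t = (\<Prod>i<n. (if d i then f else 0) - a i) - e"
  have t: "t \<in> lower_terms J f n" unfolding t_def e_def by (rule Suc) (use Suc in auto)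
  have an: "a n \<in> J" using Suc by simp
  note L = is_ideal_lower_terms[of J f "Suc n"]
  have "a n * e \<in> lower_terms J f (Suc n)"
    using ideal_times_power_in_lower_terms[OF an, of f n] is_ideal_0[OF L] by (simp add: e_def)
  then have 1: "- (a n * e) \<in> lower_terms J f (Suc n)" by (rule is_ideal_neg[OF L])
  have 2: "- (a n * t) \<in> lower_terms J f (Suc n)"
    by (rule is_ideal_neg[OF L lower_terms_times_ideal[OF t an]])
  have 3: "f * t \<in> lower_terms J f (Suc n)" by (rule lower_terms_times_self[OF t])
  have P: "(\<Prod>i<Suc n. (if d i then f else 0) - a i) = (e + t) * ((if d n then f else 0) - a n)"
    by (simp add: t_def)
  show ?case
  proof (cases "d n")
    case True
    then have "(if \<forall>i<Suc n. d i then f ^ Suc n else 0) = f * e" by (auto simp: less_Suc_eq e_def)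
    with True have "(\<Prod>i<Suc n. (if d i then f else 0) - a i) - (if \<forall>i<Suc n. d i then f ^ Suc n else 0)
       = - (a n * e) + - (a n * t) + f * t"
      unfolding P by (simp only: if_True) (simp add: algebra_simps)
    then show ?thesis using is_ideal_add[OF L is_ideal_add[OF L 1 2] 3] by simp
  next
    case False
    then have "(if \<forall>i<Suc n. d i then f ^ Suc n else 0) = 0" by auto
    with False have "(\<Prod>i<Suc n. (if d i then f else 0) - a i) - (if \<forall>i<Suc n. d i then f ^ Suc n else 0)
       = - (a n * e) + - (a n * t)"
      unfolding P by (simp only: if_False) (simp add: algebra_simps)
    then show ?thesis using is_ideal_add[OF L 1 2] by simp
  qed
qed

text \<open>In the Leibniz expansion only the identity permutation meets the diagonal in every row, so it
  alone contributes the leading term \<open>f ^ n\<close>.\<close>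

lemma det_minus_power_in_lower_terms:
  assumes A: "\<And>i j. i < n \<Longrightarrow> j < n \<Longrightarrow> A i j \<in> J"
  shows "det (mat n n (\<lambda>(i, j). (if i = j then f else 0) - A i j)) - f ^ n \<in> lower_terms J f n"
proof -
  let ?B = "mat n n (\<lambda>(i, j). (if i = j then f else 0) - A i j)"
  let ?P = "{p. p permutes {0..<n}}"
  define q where "q p = (\<Prod>i<n. (if i = p i then f else 0) - A i (p i))" for p
  note L = is_ideal_lower_terms[of J f n]
  have "det ?B = (\<Sum>p\<in>?P. signof p * (\<Prod>i=0..<n. ?B $$ (i, p i)))"
    by (rule det_def') simp
  also have "\<dots> = (\<Sum>p\<in>?P. signof p * q p)"
    unfolding q_def lessThan_atLeast0
    by (intro sum.cong arg_cong2[of _ _ _ _ "(*)"] prod.cong refl) (auto simp: permutes_in_image)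
  also have "\<dots> = signof id * q id + (\<Sum>p\<in>?P - {id}. signof p * q p)"
    by (rule sum.remove) (auto simp: finite_permutations permutes_id)
  finally have "det ?B - f ^ n = (q id - f ^ n) + (\<Sum>p\<in>?P - {id}. signof p * q p)"
    by simp
  moreover have "q id - f ^ n \<in> lower_terms J f n"
    using prod_minus_leading_in_lower_terms[of n "\<lambda>i. A i i" J "\<lambda>_. True" f] A
    by (simp add: q_def)
  moreover have "signof p * q p \<in> lower_terms J f n" if p: "p \<in> ?P - {id}" for p
  proof -
    have pn: "p i < n" if "i < n" for i using p that by (auto simp: permutes_in_image[of p "{0..<n}"] dest: permutes_in_image[of p "{0..<n}" i])
    have neg: "\<not> (\<forall>i<n. i = p i)"
    proof
      assume H: "\<forall>i<n. i = p i"
      have "p i = i" for i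
        using p H permutes_not_in[of p "{0..<n}" i] by (cases "i < n") auto
      then show False using p by auto
    qed
    have "q p \<in> lower_terms J f n"
      using prod_minus_leading_in_lower_terms[of n "\<lambda>i. A i (p i)" J "\<lambda>i. i = p i" f, OF A[OF _ pn]]
      unfolding q_def if_not_P[OF neg] diff_zero by blast
    then show ?thesis by (rule is_ideal_scale[OF L])
  qed
  then have "(\<Sum>p\<in>?P - {id}. signof p * q p) \<in> lower_terms J f n"
    by (intro is_ideal_sum is_ideal_lower_terms)
  ultimately show ?thesis using is_ideal_add[OF L] by presburger
qed

lemma smult_mat_mat_one_vec_index:
  fixes x :: "'a::comm_ring_1 Matrix.vec"
  assumes "x \<in> carrier_vec n" and "k < n"
  shows "vec_index ((c \<cdot>\<^sub>m 1\<^sub>m n) *\<^sub>v x) k = c * vec_index x k"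
proof -
  have "vec_index ((c \<cdot>\<^sub>m 1\<^sub>m n) *\<^sub>v x) k = (\<Sum>j<n. (if k = j then c else 0) * vec_index x j)"
    using assms by (auto simp: scalar_prod_def lessThan_atLeast0 intro!: sum.cong)
  also have "\<dots> = (\<Sum>j<n. if k = j then c * vec_index x j else 0)"
    by (intro sum.cong) auto
  finally show ?thesis using assms by simp
qed

text \<open>Cramer's rule over a commutative ring: multiply \<open>B x = 0\<close> by the adjugate of \<open>B\<close>.\<close>

lemma det_annihilates:
  fixes B :: "'a::comm_ring_1 mat"
  assumes B: "B \<in> carrier_mat n n" and x: "x \<in> carrier_vec n" and "B *\<^sub>v x = 0\<^sub>v n" and k: "k < n"
  shows "det B * vec_index x k = 0"
proof -
  have "(det B \<cdot>\<^sub>m 1\<^sub>m n) *\<^sub>v x = (adj_mat B * B) *\<^sub>v x" using adj_mat[OF B] by simp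
  also have "\<dots> = adj_mat B *\<^sub>v 0\<^sub>v n" using assoc_mult_mat_vec[OF adj_mat(1)[OF B] B x] assms(3) by simp
  also have "vec_index \<dots> k = 0" using adj_mat(1)[OF B] k by (auto simp: scalar_prod_def)
  finally show ?thesis using x k by (simp add: smult_mat_mat_one_vec_index) 
qed

text \<open>The relations say that \<open>f I - A\<close> kills the vector \<open>m\<close>, hence so does its determinant. One entry of
  \<open>m\<close> is not a zero divisor, so the determinant vanishes, and its expansion in powers of \<open>f\<close> is an
  equation of integral dependence.\<close>

lemma integral_by_determinant:
  fixes f :: "'a::comm_ring_1" and n :: nat
  assumes A: "\<And>i j. i < n \<Longrightarrow> j < n \<Longrightarrow> A i j \<in> J"
    and m: "\<And>i. i < n \<Longrightarrow> f * m i = (\<Sum>j<n. A i j * m j)"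
    and k: "k < n" "\<And>r. r * m k = 0 \<Longrightarrow> r = 0"
  shows "f \<in> integral_closure J"
proof -
  define B where "B = mat n n (\<lambda>(i, j). (if i = j then f else 0) - A i j)"
  have "B *\<^sub>v vec n m = 0\<^sub>v n"
  proof (rule eq_vecI)
    fix i assume "i < dim_vec (0\<^sub>v n :: 'a Matrix.vec)"
    then have i: "i < n" by simp
    have "vec_index (B *\<^sub>v vec n m) i = (\<Sum>j<n. ((if i = j then f else 0) - A i j) * m j)"
      using i by (simp add: B_def scalar_prod_def lessThan_atLeast0)
    also have "\<dots> = (\<Sum>j<n. (if i = j then f * m j else 0)) - (\<Sum>j<n. A i j * m j)"
      unfolding sum_subtractf[symmetric] by (intro sum.cong) (auto simp: algebra_simps)
    also have "\<dots> = 0" using i m[OF i] by simp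
    finally show "vec_index (B *\<^sub>v vec n m) i = vec_index (0\<^sub>v n) i" using i by simp
  qed (simp add: B_def)
  then have "det B * m k = 0"
    using det_annihilates[of B n "vec n m" k] k(1) by (simp add: B_def)
  then have "det B = 0" by (rule k(2))
  with det_minus_power_in_lower_terms[of n A J f, OF A]
  have "- (f ^ n) \<in> lower_terms J f n" by (simp add: B_def)
  moreover have "n \<ge> 1" using k(1) by simp
  ultimately show ?thesis unfolding integral_closure_iff_lower_terms by (metis add.right_inverse)
qed

text \<open>The determinant trick for the module generated by a finite family \<open>m\<close>. The hypothesis on
  \<open>m k\<close> makes the module faithful, so that only the zero determinant annihilates it.\<close>

theorem integral_if_stabilises_finite_module:
  fixes f :: "'a::comm_ring_1" and m :: "'i \<Rightarrow> 'a"
  assumes F: "finite F" and m: "\<And>u. u \<in> F \<Longrightarrow> f * m u \<in> combinations (\<lambda>_. J) m F"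
    and k: "k \<in> F" "\<And>r. r * m k = 0 \<Longrightarrow> r = 0"
  shows "f \<in> integral_closure J"
proof -
  have ex: "\<forall>u\<in>F. \<exists>c. (\<forall>w\<in>F. c w \<in> J) \<and> f * m u = (\<Sum>w\<in>F. c w * m w)"
    using m unfolding combinations_def by simp
  obtain A where A: "\<forall>u\<in>F. (\<forall>w\<in>F. A u w \<in> J) \<and> f * m u = (\<Sum>w\<in>F. A u w * m w)"
    using bchoice[OF ex] by (elim exE)
  obtain h where h: "bij_betw h {..<card F} F"
    using ex_bij_betw_nat_finite[OF F] by (auto simp: lessThan_atLeast0)
  have hF: "h i \<in> F" if "i < card F" for i using h that by (auto simp: bij_betw_def)
  have "k \<in> h ` {..<card F}" using h k(1) by (simp add: bij_betw_def)
  then obtain i where i: "i < card F" "h i = k" by auto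
  show ?thesis
  proof (rule integral_by_determinant[where n = "card F" and A = "\<lambda>i j. A (h i) (h j)"
        and J = J and f = f and m = "\<lambda>i. m (h i)" and k = i])
    show "A (h i) (h j) \<in> J" if "i < card F" "j < card F" for i j
      using A hF[OF that(1)] hF[OF that(2)] by blast
    show "f * m (h i) = (\<Sum>j<card F. A (h i) (h j) * m (h j))" if "i < card F" for i
      using A hF[OF that] sum.reindex_bij_betw[OF h, of "\<lambda>w. A (h i) w * m w"] by simp
    show "i < card F" by (rule i(1))
    show "r = 0" if "r * m (h i) = 0" for r using k(2) that i(2) by simp
  qed
qed

section \<open>Dilates of the Newton polyhedron\<close>

(* These two symbols also denote entries and scalar products of vectors of variable dimension. *)
no_notation vec_index (infixl "$" 100)
no_notation scalar_prod (infix "\<bullet>" 70)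

text \<open>The dilate \<open>n P\<close> of the Newton polyhedron of \<open>S\<close>. In this form \<open>n = 0\<close> gives the nonnegative
  orthant when \<open>S\<close> is nonempty, in accordance with the convention that the zeroth power of an
  ideal is the whole ring.\<close>

definition newton_dilate :: "(real ^ 'd) set \<Rightarrow> nat \<Rightarrow> (real ^ 'd) set"
  where "newton_dilate S n = {x. \<exists>p\<in>convex hull S. \<forall>i. real n * p $ i \<le> x $ i}"

text \<open>The affine hull of \<open>S\<close> stays in the hyperplane and so misses the origin; adjoining the origin
  therefore raises the affine dimension by one and turns the affine hull into the linear span.\<close>

lemma aff_dim_eq_dim_off_origin:
  fixes S :: "'a::euclidean_space set"
  assumes "S \<subseteq> {x. a \<bullet> x = c}" and "c \<noteq> 0"
  shows "aff_dim S + 1 = int (dim S)"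
proof -
  have "affine hull S \<subseteq> {x. a \<bullet> x = c}"
    by (rule hull_minimal) (use assms affine_hyperplane in auto)
  then have "0 \<notin> affine hull S" using assms(2) by auto
  then have "aff_dim (insert 0 S) = aff_dim S + 1"
    by (simp add: aff_dim_insert)
  moreover have "aff_dim (insert 0 S) = int (dim (insert 0 S))"
    by (rule aff_dim_zero) (simp add: hull_inc)
  ultimately show ?thesis by (metis dim_span span_insert_0)
qed

text \<open>The combinatorial heart of the theorem. By Caratheodory's theorem a point \<open>p\<close> of the convex hull
  needs at most \<open>aff_dim S + 1 \<le> n\<close> points of \<open>S\<close>. The coefficients of \<open>n p\<close> sum to \<open>n\<close>, so one of
  them is at least \<open>1\<close>, and lowering it by \<open>1\<close> leaves a point of the \<open>(n - 1)\<close>-st dilate.\<close>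

lemma newton_dilate_peel:
  fixes S :: "(real ^ 'd::finite) set"
  assumes S: "\<And>s i. s \<in> S \<Longrightarrow> 0 \<le> s $ i"
    and n: "aff_dim S + 1 \<le> int n" "n \<ge> 1"
    and x: "x \<in> newton_dilate S n"
  obtains s where "s \<in> S" and "\<And>i. s $ i \<le> x $ i" and "x - s \<in> newton_dilate S (n - 1)"
proof -
  obtain p where p: "p \<in> convex hull S" and px: "\<And>i. real n * p $ i \<le> x $ i"
    using x unfolding newton_dilate_def by blast
  obtain F where F: "finite F" "F \<subseteq> S" and card: "int (card F) \<le> aff_dim S + 1"
    and pF: "p \<in> convex hull F"
    using p unfolding caratheodory_aff_dim[of S] by blast
  obtain u where u: "\<And>s. s \<in> F \<Longrightarrow> 0 \<le> u s" "sum u F = 1" and pu: "p = (\<Sum>s\<in>F. u s *\<^sub>R s)"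
    using pF unfolding convex_hull_finite[OF F(1)] by auto
  have "\<exists>s\<in>F. 1 \<le> real n * u s"
  proof (rule ccontr)
    assume "\<not> ?thesis"
    then have "\<And>s. s \<in> F \<Longrightarrow> real n * u s < 1" by force
    moreover have "F \<noteq> {}" using u(2) by auto
    ultimately have "(\<Sum>s\<in>F. real n * u s) < (\<Sum>s\<in>F. 1)"
      using F(1) by (intro sum_strict_mono) auto
    then have "real n < real (card F)"
      by (simp add: sum_distrib_left[symmetric] u(2))
    with card n(1) show False by linarith
  qed
  then obtain s where s: "s \<in> F" "1 \<le> real n * u s" by blast
  \<comment> \<open>The coefficients of \<open>n p - s\<close>; they are nonnegative with sum \<open>n - 1\<close>.\<close>
  define w where "w t = real n * u t - (if t = s then 1 else 0)" for t
  have w0: "0 \<le> w t" if "t \<in> F" for t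
    using s(2) u(1)[OF that] by (simp add: w_def)
  have w1: "sum w F = real (n - 1)"
    using F(1) s(1) n(2) u(2) by (simp add: w_def sum_subtractf sum_distrib_left[symmetric] of_nat_diff)
  have wsum: "(\<Sum>t\<in>F. w t *\<^sub>R t) = real n *\<^sub>R p - s"
  proof -
    have "(\<Sum>t\<in>F. w t *\<^sub>R t) = (\<Sum>t\<in>F. real n *\<^sub>R u t *\<^sub>R t - (if t = s then s else 0))"
      by (intro sum.cong) (auto simp: w_def algebra_simps)
    then show ?thesis
      using F(1) s(1) by (simp add: sum_subtractf pu scaleR_sum_right)
  qed
  have sx: "s $ i \<le> x $ i" for i
  proof -
    have "0 \<le> (\<Sum>t\<in>F. w t *\<^sub>R t) $ i"
      using w0 S F(2) by (auto simp: sum_component intro!: sum_nonneg)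
    then have "s $ i \<le> real n * p $ i" unfolding wsum by simp
    with px[of i] show ?thesis by linarith
  qed
  have "x - s \<in> newton_dilate S (n - 1)"
  \<comment> \<open>For \<open>n = 1\<close> the coefficients cannot be normalised to sum 1, but only \<open>s \<le> x\<close> is needed.\<close>
  proof (cases "n = 1")
    case True
    have "s \<in> convex hull S" by (rule hull_inc[OF subsetD[OF F(2) s(1)]])
    with True sx show ?thesis unfolding newton_dilate_def by auto
  next
    case False
    then have pos: "0 < real (n - 1)" using n(2) by simp
    define q where "q = (\<Sum>t\<in>F. (w t / real (n - 1)) *\<^sub>R t)"
    have "q \<in> convex hull F"
      unfolding convex_hull_finite[OF F(1)] q_def using w0 w1 pos
      by (intro CollectI exI[of _ "\<lambda>t. w t / real (n - 1)"])
        (auto simp: sum_divide_distrib[symmetric])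
    then have "q \<in> convex hull S" by (rule subsetD[OF hull_mono[OF F(2)]])
    moreover have "real (n - 1) *\<^sub>R q = real n *\<^sub>R p - s"
      using pos unfolding q_def scaleR_sum_right wsum[symmetric] by (intro sum.cong) auto
    then have "(real (n - 1) *\<^sub>R q) $ i = (real n *\<^sub>R p - s) $ i" for i by simp
    then have "real (n - 1) * q $ i \<le> (x - s) $ i" for i
      using px[of i] unfolding vector_scaleR_component vector_minus_component real_scaleR_def
      by (metis diff_right_mono)
    ultimately show ?thesis unfolding newton_dilate_def by (intro CollectI bexI[of _ q]) simp_all
  qed
  then show ?thesis using that[OF subsetD[OF F(2) s(1)] sx] by simp
qed

lemma newton_dilate_upward:
  "x \<in> newton_dilate S n \<Longrightarrow> (\<And>i. x $ i \<le> y $ i) \<Longrightarrow> y \<in> newton_dilate S n"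
  unfolding newton_dilate_def by (blast intro: order_trans)

lemma newton_dilate_scaled_point: "s \<in> S \<Longrightarrow> real n *\<^sub>R s \<in> newton_dilate S n"
  unfolding newton_dilate_def by (auto intro!: bexI[of _ s] hull_inc)

lemma newton_dilate_add:
  assumes "x \<in> newton_dilate S m" and "y \<in> newton_dilate S n"
  shows "x + y \<in> newton_dilate S (m + n)"
proof -
  obtain p q where p: "p \<in> convex hull S" "\<And>i. real m * p $ i \<le> x $ i"
    and q: "q \<in> convex hull S" "\<And>i. real n * q $ i \<le> y $ i"
    using assms unfolding newton_dilate_def by blast
  show ?thesis
  proof (cases "m + n = 0")
    case True
    with p q show ?thesis unfolding newton_dilate_def by (auto intro!: bexI[of _ p] add_nonneg_nonneg)
  next
    case False
    define r where "r = (real m / real (m + n)) *\<^sub>R p + (real n / real (m + n)) *\<^sub>R q"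
    have "r \<in> convex hull S"
      unfolding r_def using False p(1) q(1)
      by (intro convexD[OF convex_convex_hull]) (auto simp: add_divide_distrib[symmetric])
    moreover have "real (m + n) *\<^sub>R r = real m *\<^sub>R p + real n *\<^sub>R q"
      using False by (simp add: r_def scaleR_add_right del: of_nat_add)
    then have "(real (m + n) *\<^sub>R r) $ i = (real m *\<^sub>R p + real n *\<^sub>R q) $ i" for i by simp
    then have "real (m + n) * r $ i \<le> (x + y) $ i" for i
      using add_mono[OF p(2)[of i] q(2)[of i]]
      unfolding vector_scaleR_component vector_add_component real_scaleR_def by metis
    ultimately show ?thesis unfolding newton_dilate_def by (intro CollectI bexI[of _ r]) simp_all
  qed
qed

text \<open>The sum of a compact and a closed convex set, which yields closedness and convexity.\<close>

lemma newton_dilate_eq_sum: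
  "newton_dilate S n = (\<Union>x\<in>(*\<^sub>R) (real n) ` (convex hull S). \<Union>y\<in>{y. \<forall>i. 0 \<le> y $ i}. {x + y})"
    (is "_ = ?R")
proof
  show "newton_dilate S n \<subseteq> ?R"
  proof
    fix x assume "x \<in> newton_dilate S n"
    then obtain p where "p \<in> convex hull S" "\<And>i. real n * p $ i \<le> x $ i"
      unfolding newton_dilate_def by blast
    then show "x \<in> ?R"
      by (intro UN_I[of "real n *\<^sub>R p"] UN_I[of "x - real n *\<^sub>R p"]) auto
  qed
  show "?R \<subseteq> newton_dilate S n"
  proof
    fix x assume "x \<in> ?R"
    then obtain p y where "p \<in> convex hull S" "\<forall>i. 0 \<le> y $ i" "x = real n *\<^sub>R p + y" by auto
    then show "x \<in> newton_dilate S n"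
      unfolding newton_dilate_def by (intro CollectI bexI[of _ p]) simp_all
  qed
qed

text \<open>Separate \<open>x\<close> from the closed convex set \<open>n P\<close>. The functional is bounded below on \<open>n P\<close>, and \<open>n P\<close>
  is closed under adding nonnegative vectors, so no coordinate of the functional is negative. Its
  minimum over the finite set \<open>S\<close> serves as \<open>\<beta>\<close>, which also covers \<open>n = 0\<close>.\<close>

lemma newton_dilate_supported:
  fixes S :: "(real ^ 'd::finite) set"
  assumes S: "finite S" "S \<noteq> {}" and x: "x \<notin> newton_dilate S n"
  obtains y \<beta> where "\<And>i. 0 \<le> y $ i" and "\<And>s. s \<in> S \<Longrightarrow> \<beta> \<le> y \<bullet> s" and "y \<bullet> x < real n * \<beta>"
proof -
  let ?P = "{y :: real ^ 'd. \<forall>i. 0 \<le> y $ i}"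
  have "closed ?P"
    by (intro closed_Collect_all closed_Collect_le continuous_intros)
  moreover have "compact ((*\<^sub>R) (real n) ` (convex hull S))"
    by (intro compact_scaling finite_imp_compact_convex_hull S)
  ultimately have closed: "closed (newton_dilate S n)"
    unfolding newton_dilate_eq_sum by (intro compact_closed_sums)
  have "convex ?P" by (auto simp: convex_def)
  then have convex: "convex (newton_dilate S n)"
    unfolding newton_dilate_eq_sum by (intro convex_sums convex_scaling convex_convex_hull)
  obtain y c where yx: "y \<bullet> x < c" and yc: "\<And>z. z \<in> newton_dilate S n \<Longrightarrow> c < y \<bullet> z"
    using separating_hyperplane_closed_point[OF convex closed x] by blast
  obtain s where s: "s \<in> S" and min: "\<And>t. t \<in> S \<Longrightarrow> y \<bullet> s \<le> y \<bullet> t"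
    using ex_is_arg_min_if_finite[OF S, of "\<lambda>t. y \<bullet> t"] by (auto simp: is_arg_min_linorder)
  have sn: "real n *\<^sub>R s \<in> newton_dilate S n" by (rule newton_dilate_scaled_point[OF s])
  have "0 \<le> y $ i" for i
  proof (rule ccontr)
    assume "\<not> 0 \<le> y $ i"
    then have neg: "y $ i < 0" by simp
    \<comment> \<open>Moving this far along the negative coordinate brings the functional down to exactly \<open>c\<close>.\<close>
    define t where "t = (y \<bullet> (real n *\<^sub>R s) - c) / (- y $ i)"
    have "0 \<le> t" unfolding t_def using yc[OF sn] neg by (intro divide_nonneg_pos) auto
    then have "real n *\<^sub>R s + t *\<^sub>R axis i 1 \<in> newton_dilate S n"
      by (intro newton_dilate_upward[OF sn]) (auto simp: axis_def)
    from yc[OF this] have "c < y \<bullet> (real n *\<^sub>R s) + t * y $ i"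
      by (simp add: inner_add_right inner_axis)
    moreover have "t * y $ i = c - y \<bullet> (real n *\<^sub>R s)"
      using neg by (simp add: t_def field_simps)
    ultimately show False by simp
  qed
  moreover have "y \<bullet> x < real n * (y \<bullet> s)"
    using yx yc[OF sn] by simp
  ultimately show ?thesis using that min by blast
qed

section \<open>Monomial valuations\<close>

definition expvec :: "('d \<Rightarrow>\<^sub>0 nat) \<Rightarrow> real ^ 'd"
  where "expvec k = (\<chi> i. real (Poly_Mapping.lookup k i))"

lemma expvec_nth [simp]: "expvec k $ i = real (Poly_Mapping.lookup k i)"
  by (simp add: expvec_def)

lemma expvec_add: "expvec (k + l) = expvec k + expvec l"
  by (simp add: Finite_Cartesian_Product.vec_eq_iff lookup_add)

lemma expvec_inject: "expvec k = expvec l \<longleftrightarrow> k = l"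
  by (auto simp: Finite_Cartesian_Product.vec_eq_iff intro: poly_mapping_eqI)

lemma inner_expvec_nonneg:
  assumes "\<And>i. 0 \<le> y $ i" shows "0 \<le> y \<bullet> expvec k"
  using assms by (simp add: inner_vec_def sum_nonneg)

lemma lookup_single_times_add:
  fixes g :: "'a::cancel_comm_monoid_add \<Rightarrow>\<^sub>0 'b::comm_semiring_1"
  shows "Poly_Mapping.lookup (Poly_Mapping.single a c * g) (a + k) = c * Poly_Mapping.lookup g k"
  by (simp add: lookup_mult lookup_single when_mult)

lemma monomial_nonzerodivisor:
  fixes r :: "'a::cancel_comm_monoid_add \<Rightarrow>\<^sub>0 'b::comm_semiring_1"
  assumes "r * Poly_Mapping.single u 1 = 0"
  shows "r = 0"
proof (rule poly_mapping_eqI)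
  fix k
  have "Poly_Mapping.lookup (Poly_Mapping.single u 1 * r) (u + k) = 0"
    using assms by (simp add: mult.commute)
  then show "Poly_Mapping.lookup r k = Poly_Mapping.lookup 0 k"
    by (simp add: lookup_single_times_add)
qed

lemma poly_mapping_eq_sum_single:
  "f = (\<Sum>k\<in>Poly_Mapping.keys f. Poly_Mapping.single k (Poly_Mapping.lookup f k))"
proof (rule poly_mapping_eqI)
  fix k
  have "Poly_Mapping.lookup (\<Sum>k\<in>Poly_Mapping.keys f. Poly_Mapping.single k (Poly_Mapping.lookup f k)) k
      = (\<Sum>l\<in>Poly_Mapping.keys f. if k = l then Poly_Mapping.lookup f l else 0)"
    unfolding lookup_sum by (intro sum.cong) (auto simp: lookup_single when_def)
  also have "\<dots> = Poly_Mapping.lookup f k"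
    by (simp add: in_keys_iff)
  finally show "Poly_Mapping.lookup f k = Poly_Mapping.lookup
    (\<Sum>k\<in>Poly_Mapping.keys f. Poly_Mapping.single k (Poly_Mapping.lookup f k)) k" by simp
qed

text \<open>If \<open>a + k\<close> arises in only one way, no other pair of terms contributes to its coefficient. This
  gives control of leading coefficients without a monomial order, and so without an order on the
  variables.\<close>

lemma lookup_times_unique_decomposition:
  fixes f g :: "'a::cancel_comm_monoid_add \<Rightarrow>\<^sub>0 'b::comm_ring_1"
  assumes uniq: "\<And>s t. s \<in> Poly_Mapping.keys f \<Longrightarrow> t \<in> Poly_Mapping.keys g \<Longrightarrow> s + t = a + k \<Longrightarrow> s = a"
  shows "Poly_Mapping.lookup (f * g) (a + k) = Poly_Mapping.lookup f a * Poly_Mapping.lookup g k"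
proof -
  define h where "h = f - Poly_Mapping.single a (Poly_Mapping.lookup f a)"
  have h: "s \<in> Poly_Mapping.keys f \<and> s \<noteq> a" if "s \<in> Poly_Mapping.keys h" for s
    using that by (auto simp: h_def in_keys_iff lookup_minus lookup_single when_def split: if_splits)
  have "a + k \<notin> Poly_Mapping.keys (h * g)"
  proof
    assume "a + k \<in> Poly_Mapping.keys (h * g)"
    then obtain s t where "s \<in> Poly_Mapping.keys h" "t \<in> Poly_Mapping.keys g" "a + k = s + t"
      using keys_mult[of h g] by auto
    with h uniq[of s t] show False by auto
  qed
  moreover have "f * g = Poly_Mapping.single a (Poly_Mapping.lookup f a) * g + h * g"
    by (simp add: h_def algebra_simps)
  ultimately show ?thesis
    by (simp add: lookup_add lookup_single_times_add in_keys_iff)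
qed

text \<open>The polynomials of order at least \<open>\<gamma>\<close> for the monomial valuation with weights \<open>y\<close>.\<close>

definition order_ideal :: "real ^ 'd \<Rightarrow> real \<Rightarrow> ('d::finite, 'k::field) polyring set"
  where "order_ideal y \<gamma> = {f. \<forall>k\<in>Poly_Mapping.keys f. \<gamma> \<le> y \<bullet> expvec k}"

lemma order_ideal_mult:
  assumes "f \<in> order_ideal y \<gamma>" and "g \<in> order_ideal y \<delta>"
  shows "f * g \<in> order_ideal y (\<gamma> + \<delta>)"
  unfolding order_ideal_def
proof (intro CollectI ballI)
  fix k assume "k \<in> Poly_Mapping.keys (f * g)"
  then obtain s t where "s \<in> Poly_Mapping.keys f" "t \<in> Poly_Mapping.keys g" "k = s + t"
    using keys_mult[of f g] by auto
  then show "\<gamma> + \<delta> \<le> y \<bullet> expvec k"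
    using assms by (auto simp: order_ideal_def expvec_add inner_add_right intro: add_mono)
qed

lemma order_ideal_zero_UNIV:
  assumes "\<And>i. 0 \<le> y $ i" shows "order_ideal y 0 = UNIV"
  using inner_expvec_nonneg[OF assms] by (auto simp: order_ideal_def)

lemma is_ideal_order_ideal:
  assumes "\<And>i. 0 \<le> y $ i"
  shows "is_ideal (order_ideal y \<gamma>)"
  unfolding is_ideal_iff
proof (intro conjI ballI allI)
  show "0 \<in> order_ideal y \<gamma>" by (simp add: order_ideal_def)
  show "f + g \<in> order_ideal y \<gamma>" if "f \<in> order_ideal y \<gamma>" "g \<in> order_ideal y \<gamma>" for f g
    using that keys_add[of f g] unfolding order_ideal_def by auto
  show "r * f \<in> order_ideal y \<gamma>" if "f \<in> order_ideal y \<gamma>" for r f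
    using order_ideal_mult[of r y 0 f \<gamma>] that by (simp add: order_ideal_zero_UNIV[OF assms])
qed

lemma ideal_power_subset_order_ideal:
  assumes y: "\<And>i. 0 \<le> y $ i" and J: "J \<subseteq> order_ideal y \<gamma>"
  shows "ideal_power J n \<subseteq> order_ideal y (real n * \<gamma>)"
proof (induction n)
  case 0
  then show ?case by (simp add: order_ideal_zero_UNIV[OF y])
next
  case (Suc n)
  have "ideal_mult J (ideal_power J n) \<subseteq> order_ideal y (\<gamma> + real n * \<gamma>)"
    by (rule ideal_mult_least[OF is_ideal_order_ideal[OF y]])
      (use J Suc order_ideal_mult in \<open>blast\<close>)
  then show ?case by (simp add: algebra_simps)
qed

lemma power_in_order_ideal:
  assumes y: "\<And>i. 0 \<le> y $ i" and f: "f \<in> order_ideal y \<gamma>"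
  shows "f ^ n \<in> order_ideal y (real n * \<gamma>)"
proof (induction n)
  case 0
  then show ?case by (simp add: order_ideal_zero_UNIV[OF y])
next
  case (Suc n)
  show ?case using order_ideal_mult[OF f Suc] by (simp add: algebra_simps)
qed

text \<open>The equality case of the triangle inequality in an inner product space. It is the reason why a
  point of largest norm in a finite set is a vertex.\<close>

lemma eq_if_norm_le_and_sum:
  fixes a s k :: "'a::real_inner"
  assumes "norm s \<le> norm a" and "norm k \<le> real n * norm a" and "s + k = real (Suc n) *\<^sub>R a"
  shows "s = a"
proof -
  have "s \<bullet> a + k \<bullet> a = real (Suc n) * (norm a)\<^sup>2"
    using assms(3) by (metis inner_add_left inner_scaleR_left power2_norm_eq_inner)
  moreover have "k \<bullet> a \<le> real n * (norm a)\<^sup>2"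
    using norm_cauchy_schwarz[of k a] mult_right_mono[OF assms(2), of "norm a"]
    by (simp add: power2_eq_square)
  ultimately have "(norm a)\<^sup>2 \<le> s \<bullet> a" by (simp add: algebra_simps)
  moreover have "(norm s)\<^sup>2 \<le> (norm a)\<^sup>2" using assms(1) by (simp add: power_mono)
  moreover have "(norm (s - a))\<^sup>2 = (norm s)\<^sup>2 - 2 * (s \<bullet> a) + (norm a)\<^sup>2"
    unfolding power2_norm_eq_inner by (simp add: algebra_simps inner_commute)
  ultimately have "(norm (s - a))\<^sup>2 \<le> 0" by linarith
  then show ?thesis by simp
qed

text \<open>Among the exponents of \<open>f\<close> of least weight, choose \<open>a\<close> of largest Euclidean norm. Then \<open>n a\<close> is a
  sum of \<open>n\<close> exponents of \<open>f\<close> only in the obvious way, because all summands must have least weight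
  and a sum of shorter vectors is \<open>n a\<close> only if all of them equal \<open>a\<close>. Hence no cancellation occurs at
  \<open>n a\<close> in \<open>f ^ n\<close>. The bounds on the exponents of \<open>f ^ n\<close> are carried along for the induction.\<close>

lemma power_keeps_vertex:
  fixes f :: "('d::finite, 'k::field) polyring"
  assumes min: "\<And>s. s \<in> Poly_Mapping.keys f \<Longrightarrow> y \<bullet> expvec a \<le> y \<bullet> expvec s"
    and far: "\<And>s. s \<in> Poly_Mapping.keys f \<Longrightarrow> y \<bullet> expvec s = y \<bullet> expvec a \<Longrightarrow> norm (expvec s) \<le> norm (expvec a)"
  shows "(\<forall>l\<in>Poly_Mapping.keys (f ^ n). real n * (y \<bullet> expvec a) \<le> y \<bullet> expvec l \<and>
      (y \<bullet> expvec l = real n * (y \<bullet> expvec a) \<longrightarrow> norm (expvec l) \<le> real n * norm (expvec a)))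
    \<and> (\<exists>k. expvec k = real n *\<^sub>R expvec a \<and> Poly_Mapping.lookup (f ^ n) k = Poly_Mapping.lookup f a ^ n)"
proof (induction n)
  case 0
  have "expvec (0 :: 'd \<Rightarrow>\<^sub>0 nat) = 0" by (simp add: Finite_Cartesian_Product.vec_eq_iff)
  then show ?case by (auto simp: lookup_one intro!: exI[of _ 0] split: if_splits)
next
  case (Suc n)
  let ?m = "y \<bullet> expvec a"
  have low: "real n * ?m \<le> y \<bullet> expvec l" if "l \<in> Poly_Mapping.keys (f ^ n)" for l
    using Suc that by simp
  have nrm: "norm (expvec l) \<le> real n * norm (expvec a)"
    if "l \<in> Poly_Mapping.keys (f ^ n)" "y \<bullet> expvec l = real n * ?m" for l
    using Suc that by simp
  obtain k where k: "expvec k = real n *\<^sub>R expvec a"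
    and ck: "Poly_Mapping.lookup (f ^ n) k = Poly_Mapping.lookup f a ^ n"
    using Suc by auto
  have split: "real (Suc n) * ?m \<le> y \<bullet> expvec (s + t) \<and>
      (y \<bullet> expvec (s + t) = real (Suc n) * ?m \<longrightarrow>
        norm (expvec s) \<le> norm (expvec a) \<and> norm (expvec t) \<le> real n * norm (expvec a))"
    if st: "s \<in> Poly_Mapping.keys f" "t \<in> Poly_Mapping.keys (f ^ n)" for s t
  proof -
    have e: "y \<bullet> expvec (s + t) = y \<bullet> expvec s + y \<bullet> expvec t" "real (Suc n) * ?m = ?m + real n * ?m"
      by (simp_all add: expvec_add inner_add_right algebra_simps)
    show ?thesis
    proof (intro conjI impI)
      show "real (Suc n) * ?m \<le> y \<bullet> expvec (s + t)"
        unfolding e using min[OF st(1)] low[OF st(2)] by linarith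
      assume "y \<bullet> expvec (s + t) = real (Suc n) * ?m"
      then have "y \<bullet> expvec s = ?m" "y \<bullet> expvec t = real n * ?m"
        unfolding e using min[OF st(1)] low[OF st(2)] by linarith+
      then show "norm (expvec s) \<le> norm (expvec a)" "norm (expvec t) \<le> real n * norm (expvec a)"
        using far[OF st(1)] nrm[OF st(2)] by auto
    qed
  qed
  have 1: "\<forall>l\<in>Poly_Mapping.keys (f ^ Suc n). real (Suc n) * ?m \<le> y \<bullet> expvec l \<and>
      (y \<bullet> expvec l = real (Suc n) * ?m \<longrightarrow> norm (expvec l) \<le> real (Suc n) * norm (expvec a))"
  proof
    fix l assume "l \<in> Poly_Mapping.keys (f ^ Suc n)"
    then obtain s t where st: "s \<in> Poly_Mapping.keys f" "t \<in> Poly_Mapping.keys (f ^ n)" and l: "l = s + t"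
      using keys_mult[of f "f ^ n"] by auto
    have "norm (expvec l) \<le> norm (expvec s) + norm (expvec t)"
      unfolding l expvec_add by (rule norm_triangle_ineq)
    moreover have "real (Suc n) * norm (expvec a) = norm (expvec a) + real n * norm (expvec a)"
      by (simp add: algebra_simps)
    ultimately show "real (Suc n) * ?m \<le> y \<bullet> expvec l \<and>
      (y \<bullet> expvec l = real (Suc n) * ?m \<longrightarrow> norm (expvec l) \<le> real (Suc n) * norm (expvec a))"
      using split[OF st] unfolding l by linarith
  qed
  have ak: "expvec (a + k) = real (Suc n) *\<^sub>R expvec a"
    by (simp add: expvec_add k algebra_simps)
  have "Poly_Mapping.lookup (f * f ^ n) (a + k) = Poly_Mapping.lookup f a * Poly_Mapping.lookup (f ^ n) k"
  proof (rule lookup_times_unique_decomposition)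
    fix s t assume st: "s \<in> Poly_Mapping.keys f" "t \<in> Poly_Mapping.keys (f ^ n)" and eq: "s + t = a + k"
    have "y \<bullet> expvec (s + t) = real (Suc n) * ?m" unfolding eq ak by simp
    with split[OF st] have "norm (expvec s) \<le> norm (expvec a)" "norm (expvec t) \<le> real n * norm (expvec a)"
      by auto
    moreover have "expvec s + expvec t = real (Suc n) *\<^sub>R expvec a"
      using ak unfolding eq[symmetric] expvec_add .
    ultimately have "expvec s = expvec a" by (rule eq_if_norm_le_and_sum)
    then show "s = a" by (simp only: expvec_inject)
  qed
  then have "Poly_Mapping.lookup (f ^ Suc n) (a + k) = Poly_Mapping.lookup f a ^ Suc n" by (simp add: ck)
  with 1 ak show ?case by blast
qed

text \<open>Let \<open>m\<close> be the least weight of an exponent of \<open>f\<close>. An equation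
  \<open>f\<^sup>n + c\<^sub>1 f\<^sup>n\<^sup>-\<^sup>1 + \<dots> + c\<^sub>n = 0\<close> must cancel the vertex term of \<open>f\<^sup>n\<close>, which has weight
  \<open>n m\<close>, by a term of some \<open>c\<^sub>i f\<^sup>n\<^sup>-\<^sup>i\<close>, which has weight at least \<open>i \<gamma> + (n - i) m\<close>. Hence
  \<open>\<gamma> \<le> m\<close>.\<close>

lemma integral_closure_subset_order_ideal:
  fixes J :: "('d::finite, 'k::field) polyring set"
  assumes y: "\<And>i. 0 \<le> y $ i" and J: "J \<subseteq> order_ideal y \<gamma>"
  shows "integral_closure J \<subseteq> order_ideal y \<gamma>"
proof
  fix f assume "f \<in> integral_closure J"
  then obtain n t where n: "n \<ge> 1" and t: "t \<in> lower_terms J f n" and eq: "f ^ n + t = 0"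
    unfolding integral_closure_iff_lower_terms by blast
  obtain c where c: "\<forall>i\<in>{1..n}. c i \<in> ideal_power J i" and tc: "t = (\<Sum>i=1..n. c i * f ^ (n - i))"
    using t by (elim combinationsE)
  show "f \<in> order_ideal y \<gamma>"
  proof (cases "f = 0")
    case True
    then show ?thesis by (simp add: order_ideal_def)
  next
    case False
    let ?K = "Poly_Mapping.keys f"
    have K: "finite ?K" "?K \<noteq> {}" using False by simp_all
    obtain a0 where a0: "a0 \<in> ?K" "\<And>s. s \<in> ?K \<Longrightarrow> y \<bullet> expvec a0 \<le> y \<bullet> expvec s"
      using ex_is_arg_min_if_finite[OF K, of "\<lambda>s. y \<bullet> expvec s"] by (auto simp: is_arg_min_linorder)
    \<comment> \<open>Ties among the exponents of least weight are broken by the norm, to reach a vertex.\<close>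
    let ?M = "{s \<in> ?K. y \<bullet> expvec s = y \<bullet> expvec a0}"
    have M: "finite ?M" "?M \<noteq> {}" using K a0 by auto
    obtain a where a: "a \<in> ?M" "\<And>s. s \<in> ?M \<Longrightarrow> - norm (expvec a) \<le> - norm (expvec s)"
      using ex_is_arg_min_if_finite[OF M, of "\<lambda>s. - norm (expvec s)"] by (auto simp: is_arg_min_linorder)
    let ?m = "y \<bullet> expvec a"
    have min: "?m \<le> y \<bullet> expvec s" if "s \<in> ?K" for s using a(1) a0(2)[OF that] by simp
    have far: "norm (expvec s) \<le> norm (expvec a)" if "s \<in> ?K" "y \<bullet> expvec s = ?m" for s
      using a(1) a(2)[of s] that by simp
    obtain k where k: "expvec k = real n *\<^sub>R expvec a"
      and ck: "Poly_Mapping.lookup (f ^ n) k = Poly_Mapping.lookup f a ^ n"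
      using power_keeps_vertex[of f y a n, OF min far] by blast
    have "Poly_Mapping.lookup (f ^ n) k \<noteq> 0"
      unfolding ck using a(1) by (simp add: in_keys_iff)
    moreover have "f ^ n = - t" using eq by (simp add: eq_neg_iff_add_eq_0)
    ultimately have "k \<in> Poly_Mapping.keys t" by (simp add: in_keys_iff lookup_uminus)
    then have "k \<in> (\<Union>i\<in>{1..n}. Poly_Mapping.keys (c i * f ^ (n - i)))"
      unfolding tc by (rule subsetD[OF keys_sum])
    then obtain i where i: "i \<in> {1..n}" and ki: "k \<in> Poly_Mapping.keys (c i * f ^ (n - i))" by blast
    have fm: "f \<in> order_ideal y ?m" using min by (simp add: order_ideal_def)
    have "c i \<in> order_ideal y (real i * \<gamma>)"
      using c i ideal_power_subset_order_ideal[OF y J, of i] by auto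
    from order_ideal_mult[OF this power_in_order_ideal[OF y fm, of "n - i"]]
    have "real i * \<gamma> + real (n - i) * ?m \<le> y \<bullet> expvec k"
      using ki by (simp add: order_ideal_def)
    also have "\<dots> = real n * ?m" by (simp add: k)
    also have "\<dots> = real i * ?m + real (n - i) * ?m" using i by (simp add: of_nat_diff algebra_simps)
    finally have "\<gamma> \<le> ?m" using i by simp
    then show ?thesis using min by (auto simp: order_ideal_def intro: order_trans)
  qed
qed

section \<open>Lattice points of the Newton polyhedron as exponents\<close>

lemma variable_power: "variable i ^ n = Poly_Mapping.single (Poly_Mapping.single i n) 1"
  by (induction n) (simp_all add: variable_def mult_single single_add[symmetric])

lemma prod_single_one:
  "(\<Prod>i\<in>A. Poly_Mapping.single (e i) 1) = Poly_Mapping.single (\<Sum>i\<in>A. e i) (1 :: 'b::comm_semiring_1)"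
  by (induction A rule: infinite_finite_induct) (simp_all add: mult_single)

lemma expvec_surj_real_vec:
  obtains e where "expvec e = real_vec a"
proof
  show "expvec (Abs_poly_mapping (\<lambda>i. a $ i)) = real_vec a"
    by (simp add: Finite_Cartesian_Product.vec_eq_iff real_vec_def)
qed

lemma xpow_eq_single:
  assumes "expvec e = real_vec a"
  shows "xpow a = Poly_Mapping.single e 1"
proof -
  have e: "Poly_Mapping.lookup e i = a $ i" for i
    using assms by (simp add: Finite_Cartesian_Product.vec_eq_iff real_vec_def)
  have "(\<Sum>i\<in>UNIV. Poly_Mapping.single i (a $ i)) = e"
  proof (rule poly_mapping_eqI)
    fix j
    have "Poly_Mapping.lookup (\<Sum>i\<in>UNIV. Poly_Mapping.single i (a $ i)) j = (\<Sum>i\<in>UNIV. if i = j then a $ i else 0)"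
      unfolding lookup_sum by (intro sum.cong) (auto simp: lookup_single when_def)
    then show "Poly_Mapping.lookup (\<Sum>i\<in>UNIV. Poly_Mapping.single i (a $ i)) j = Poly_Mapping.lookup e j"
      by (simp add: e)
  qed
  then show ?thesis
    by (simp add: xpow_def variable_power prod_single_one)
qed

lemma expvec_le_imp_add:
  assumes "\<And>i. expvec e $ i \<le> expvec u $ i"
  obtains w where "u = e + w"
proof
  show "u = e + (u - e)"
    by (rule poly_mapping_eqI) (use assms in \<open>simp add: lookup_add lookup_minus\<close>)
qed

lemma exponent_peel:
  fixes v :: "'q \<Rightarrow> nat ^ 'd::finite"
  defines "S \<equiv> range (\<lambda>j. real_vec (v j))"
  assumes n: "aff_dim S + 1 \<le> int n" "n \<ge> 1" and u: "expvec u \<in> newton_dilate S n"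
  obtains j e w where "expvec e = real_vec (v j)" and "u = e + w" and "expvec w \<in> newton_dilate S (n - 1)"
proof -
  have S: "0 \<le> s $ i" if "s \<in> S" for s i using that by (auto simp: S_def real_vec_def)
  obtain s where s: "s \<in> S" "\<And>i. s $ i \<le> expvec u $ i" "expvec u - s \<in> newton_dilate S (n - 1)"
    using newton_dilate_peel[OF S n u] by metis
  obtain j where j: "s = real_vec (v j)" using s(1) by (auto simp: S_def)
  obtain e where e: "expvec e = real_vec (v j)" by (rule expvec_surj_real_vec)
  have "expvec e $ i \<le> expvec u $ i" for i using s(2)[of i] unfolding j e .
  then obtain w where w: "u = e + w" by (rule expvec_le_imp_add)
  have "expvec w \<in> newton_dilate S (n - 1)"
    using s(3) by (simp add: j e[symmetric] w expvec_add)
  with e w show ?thesis by (rule that)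
qed

text \<open>Peeling \<open>n\<close> times from level \<open>T + n\<close> stays above the threshold \<open>aff_dim S + 1\<close> throughout, and the
  generators removed multiply to an element of \<open>I\<^sup>n\<close>.\<close>

lemma exponent_peel_power:
  fixes v :: "'q \<Rightarrow> nat ^ 'd::finite"
  defines "S \<equiv> range (\<lambda>j. real_vec (v j))"
    and "I \<equiv> ideal_gen (range (\<lambda>j. xpow (v j) :: ('d, 'k::field) polyring))"
  assumes T: "aff_dim S + 1 \<le> int T" and "expvec u \<in> newton_dilate S (T + n)"
  shows "\<exists>e w. u = e + w \<and> Poly_Mapping.single e 1 \<in> ideal_power I n \<and> expvec w \<in> newton_dilate S T"
  using assms(4)
proof (induction n arbitrary: u)
  case 0
  then show ?case by (intro exI[of _ 0] exI[of _ u]) simp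
next
  case (Suc n)
  have "aff_dim S + 1 \<le> int (T + Suc n)" "T + Suc n \<ge> 1" using T by simp_all
  then obtain j e w where e: "expvec e = real_vec (v j)" and u: "u = e + w"
    and w: "expvec w \<in> newton_dilate S (T + Suc n - 1)"
    using exponent_peel[of v "T + Suc n" u] Suc.prems unfolding S_def by metis
  obtain e' w' where e': "w = e' + w'" "Poly_Mapping.single e' 1 \<in> ideal_power I n"
    and w': "expvec w' \<in> newton_dilate S T"
    using Suc.IH[of w] w by auto
  have "xpow (v j) \<in> I"
    unfolding I_def by (rule subsetD[OF ideal_gen_superset]) simp
  then have "Poly_Mapping.single e 1 \<in> I" by (simp add: xpow_eq_single[OF e])
  from ideal_mult_memI[OF this e'(2)]
  have "Poly_Mapping.single (e + e') 1 \<in> ideal_power I (Suc n)" by (simp add: mult_single)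
  moreover have "u = (e + e') + w'" by (simp add: u e'(1) add.assoc)
  ultimately show ?case using w' by blast
qed

lemma finite_bounded_exponents:
  "finite {u :: 'd::finite \<Rightarrow>\<^sub>0 nat. \<forall>i. Poly_Mapping.lookup u i \<le> B}"
proof (rule finite_imageD)
  have "Poly_Mapping.lookup ` {u :: 'd \<Rightarrow>\<^sub>0 nat. \<forall>i. Poly_Mapping.lookup u i \<le> B} \<subseteq> (\<Pi>\<^sub>E i\<in>UNIV. {..B})"
    by (auto simp: PiE_def)
  then show "finite (Poly_Mapping.lookup ` {u :: 'd \<Rightarrow>\<^sub>0 nat. \<forall>i. Poly_Mapping.lookup u i \<le> B})"
    by (rule finite_subset) (intro finite_PiE; simp)
qed (simp add: inj_on_def poly_mapping_eqI)

text \<open>Finite generation of the lattice points of \<open>n P\<close>: rounding up a point \<open>n p\<close> with \<open>p\<close> in the convex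
  hull gives a lattice point of \<open>n P\<close> that is below every lattice point above \<open>n p\<close>, and its
  coordinates are bounded because the convex hull is.\<close>

lemma newton_dilate_finitely_generated:
  fixes S :: "(real ^ 'd::finite) set"
  assumes "finite S"
  obtains F where "finite F" and "\<And>u. u \<in> F \<Longrightarrow> expvec u \<in> newton_dilate S n"
    and "\<And>u. expvec u \<in> newton_dilate S n \<Longrightarrow> \<exists>w\<in>F. \<exists>z. u = w + z"
proof -
  have "bounded (convex hull S)"
    by (intro compact_imp_bounded finite_imp_compact_convex_hull assms)
  then obtain M where M: "\<And>p. p \<in> convex hull S \<Longrightarrow> norm p \<le> M"
    unfolding bounded_iff by blast
  define B where "B = nat \<lceil>real n * M\<rceil>"
  define F where "F = {u. expvec u \<in> newton_dilate S n} \<inter> {u :: 'd \<Rightarrow>\<^sub>0 nat. \<forall>i. Poly_Mapping.lookup u i \<le> B}"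
  show ?thesis
  proof (rule that)
    show "finite F" unfolding F_def using finite_bounded_exponents by blast
    show "expvec u \<in> newton_dilate S n" if "u \<in> F" for u using that by (simp add: F_def)
    show "\<exists>w\<in>F. \<exists>z. u = w + z" if u: "expvec u \<in> newton_dilate S n" for u
    proof -
      obtain p where p: "p \<in> convex hull S" and pu: "\<And>i. real n * p $ i \<le> expvec u $ i"
        using u unfolding newton_dilate_def by blast
      define w where "w = Abs_poly_mapping (\<lambda>i. nat \<lceil>real n * p $ i\<rceil>)"
      have w: "Poly_Mapping.lookup w i = nat \<lceil>real n * p $ i\<rceil>" for i
        by (simp add: w_def)
      have "real n * p $ i \<le> expvec w $ i" for i
        unfolding expvec_nth w by linarith
      then have wn: "expvec w \<in> newton_dilate S n"
        using p unfolding newton_dilate_def by blast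
      have "Poly_Mapping.lookup w i \<le> B" for i
      proof -
        have "p $ i \<le> M" using component_le_norm_cart[of p i] M[OF p] by linarith
        then show ?thesis unfolding w B_def by (intro nat_mono ceiling_mono mult_left_mono) simp_all
      qed
      with wn have "w \<in> F" by (simp add: F_def)
      moreover have "expvec w $ i \<le> expvec u $ i" for i
      proof -
        have "nat \<lceil>real n * p $ i\<rceil> \<le> Poly_Mapping.lookup u i" using pu[of i] by (simp add: ceiling_le_iff)
        then show ?thesis unfolding expvec_nth w by simp
      qed
      then obtain z where "u = w + z" by (rule expvec_le_imp_add)
      ultimately show ?thesis by blast
    qed
  qed
qed

section \<open>Integral closures of powers of monomial ideals\<close>

definition newton_ideal :: "(real ^ 'd) set \<Rightarrow> nat \<Rightarrow> ('d::finite, 'k::field) polyring set"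
  where "newton_ideal S n = {f. \<forall>k\<in>Poly_Mapping.keys f. expvec k \<in> newton_dilate S n}"

lemma newton_ideal_mult:
  assumes "f \<in> newton_ideal S m" and "g \<in> newton_ideal S n"
  shows "f * g \<in> newton_ideal S (m + n)"
  unfolding newton_ideal_def
proof (intro CollectI ballI)
  fix k assume "k \<in> Poly_Mapping.keys (f * g)"
  then obtain s t where "s \<in> Poly_Mapping.keys f" "t \<in> Poly_Mapping.keys g" "k = s + t"
    using keys_mult[of f g] by auto
  then show "expvec k \<in> newton_dilate S (m + n)"
    using assms by (simp add: newton_ideal_def expvec_add newton_dilate_add)
qed

lemma is_ideal_newton_ideal: "is_ideal (newton_ideal S n)"
  unfolding is_ideal_iff
proof (intro conjI ballI allI)
  show "0 \<in> newton_ideal S n" by (simp add: newton_ideal_def)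
  show "f + g \<in> newton_ideal S n" if "f \<in> newton_ideal S n" "g \<in> newton_ideal S n" for f g
    using that keys_add[of f g] unfolding newton_ideal_def by auto
  show "r * f \<in> newton_ideal S n" if f: "f \<in> newton_ideal S n" for r f
    unfolding newton_ideal_def
  proof (intro CollectI ballI)
    fix k assume "k \<in> Poly_Mapping.keys (r * f)"
    then obtain s t where st: "t \<in> Poly_Mapping.keys f" "k = s + t"
      using keys_mult[of r f] by auto
    then have "expvec t \<in> newton_dilate S n" using f by (simp add: newton_ideal_def)
    then show "expvec k \<in> newton_dilate S n"
      by (rule newton_dilate_upward) (simp add: st(2) lookup_add)
  qed
qed

lemma xpow_in_newton_ideal:
  assumes "real_vec a \<in> S" shows "xpow a \<in> newton_ideal S 1"
proof -
  obtain e where e: "expvec e = real_vec a" by (rule expvec_surj_real_vec)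
  have "expvec e \<in> newton_dilate S 1"
    using newton_dilate_scaled_point[OF assms, of 1] by (simp add: e)
  then show ?thesis by (simp add: newton_ideal_def xpow_eq_single[OF e])
qed

text \<open>Let \<open>M\<close> be the ideal generated by the monomials with exponent in \<open>T P\<close>. Multiplying such a monomial
  by a term of \<open>f\<close> gives an exponent in \<open>(T + n) P\<close>, and peeling off \<open>n\<close> generators shows that the
  product is in \<open>I\<^sup>n M\<close>. The determinant trick applies to \<open>f M \<subseteq> I\<^sup>n M\<close>.\<close>

lemma newton_ideal_subset_integral_closure:
  fixes v :: "'q::finite \<Rightarrow> nat ^ 'd::finite"
  defines "S \<equiv> range (\<lambda>j. real_vec (v j))"
    and "I \<equiv> ideal_gen (range (\<lambda>j. xpow (v j) :: ('d, 'k::field) polyring))"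
  shows "newton_ideal S n \<subseteq> integral_closure (ideal_power I n)"
proof
  fix f :: "('d, 'k) polyring" assume f: "f \<in> newton_ideal S n"
  define T where "T = nat (aff_dim S + 1)"
  have T: "aff_dim S + 1 \<le> int T" by (simp add: T_def)
  have "finite S" by (simp add: S_def)
  then obtain F where F: "finite F" and FT: "\<And>u. u \<in> F \<Longrightarrow> expvec u \<in> newton_dilate S T"
    and gen: "\<And>u. expvec u \<in> newton_dilate S T \<Longrightarrow> \<exists>w\<in>F. \<exists>z. u = w + z"
    using newton_dilate_finitely_generated[of S T] by metis
  let ?m = "\<lambda>u. Poly_Mapping.single u 1 :: ('d, 'k) polyring"
  let ?J = "ideal_power I n"
  let ?C = "combinations (\<lambda>_. ?J) ?m F"
  have C: "is_ideal ?C" by (rule is_ideal_combinations[OF is_ideal_ideal_power])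
  have mono: "?m u \<in> ?C" if u: "expvec u \<in> newton_dilate S (T + n)" for u
  proof -
    obtain e w where ew: "u = e + w" and e: "?m e \<in> ?J" and w: "expvec w \<in> newton_dilate S T"
      using exponent_peel_power[of v T u n, where ?'k = 'k, folded S_def I_def, OF T u]
      by (elim exE conjE)
    obtain w' z where w': "w' \<in> F" "w = w' + z" using gen[OF w] by blast
    have "?m z * ?m e \<in> ?J" by (rule is_ideal_scale[OF is_ideal_ideal_power e])
    then have "(?m z * ?m e) * ?m w' \<in> ?C"
      by (intro combinations_member is_ideal_ideal_power F w'(1))
    moreover have "?m u = (?m z * ?m e) * ?m w'"
      by (simp add: mult_single ew w'(2) add_ac)
    ultimately show ?thesis by simp
  qed
  \<comment> \<open>The module is nonzero: it contains the \<open>T\<close>-th power of any generator of the ideal.\<close>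
  define j :: 'q where "j = undefined"
  obtain e where e: "expvec e = real_vec (v j)" by (rule expvec_surj_real_vec)
  have "expvec (\<Sum>i<T. e) = real T *\<^sub>R expvec e"
    by (simp add: Finite_Cartesian_Product.vec_eq_iff lookup_sum)
  then have "expvec (\<Sum>i<T. e) \<in> newton_dilate S T"
    using newton_dilate_scaled_point[of "real_vec (v j)" S T] by (simp add: e S_def)
  then obtain k where k: "k \<in> F" using gen by blast
  show "f \<in> integral_closure ?J"
  proof (rule integral_if_stabilises_finite_module[OF F _ k])
    show "r = 0" if "r * ?m k = 0" for r using that by (rule monomial_nonzerodivisor)
    show "f * ?m u \<in> ?C" if u: "u \<in> F" for u
    proof -
      have "Poly_Mapping.single l (Poly_Mapping.lookup f l) * ?m u \<in> ?C" if "l \<in> Poly_Mapping.keys f" for l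
      proof -
        have "expvec (u + l) \<in> newton_dilate S (T + n)"
          unfolding expvec_add using f that FT[OF u] by (intro newton_dilate_add) (auto simp: newton_ideal_def)
        then have "Poly_Mapping.single 0 (Poly_Mapping.lookup f l) * ?m (u + l) \<in> ?C"
          by (intro is_ideal_scale[OF C] mono)
        then show ?thesis by (simp add: mult_single add.commute)
      qed
      then have "(\<Sum>l\<in>Poly_Mapping.keys f. Poly_Mapping.single l (Poly_Mapping.lookup f l) * ?m u) \<in> ?C"
        by (rule is_ideal_sum[OF C])
      then show ?thesis
        unfolding sum_distrib_right[symmetric] poly_mapping_eq_sum_single[symmetric] .
    qed
  qed
qed

text \<open>An exponent outside \<open>n P\<close> violates one supporting inequality, while the whole integral closure
  obeys it, because the corresponding order ideal contains the generators.\<close>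

lemma integral_closure_subset_newton_ideal:
  fixes v :: "'q::finite \<Rightarrow> nat ^ 'd::finite"
  defines "S \<equiv> range (\<lambda>j. real_vec (v j))"
    and "I \<equiv> ideal_gen (range (\<lambda>j. xpow (v j) :: ('d, 'k::field) polyring))"
  shows "integral_closure (ideal_power I n) \<subseteq> newton_ideal S n"
proof
  fix f assume f: "f \<in> integral_closure (ideal_power I n)"
  show "f \<in> newton_ideal S n"
    unfolding newton_ideal_def
  proof (intro CollectI ballI)
    fix k assume k: "k \<in> Poly_Mapping.keys f"
    show "expvec k \<in> newton_dilate S n"
    proof (rule ccontr)
      assume out: "expvec k \<notin> newton_dilate S n"
      have "finite S" "S \<noteq> {}" by (simp_all add: S_def)
      then obtain y \<beta> where y: "\<And>i. 0 \<le> y $ i" and \<beta>: "\<And>s. s \<in> S \<Longrightarrow> \<beta> \<le> y \<bullet> s"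
        and yk: "y \<bullet> expvec k < real n * \<beta>"
        using newton_dilate_supported[OF _ _ out] by metis
      have "xpow (v j) \<in> order_ideal y \<beta>" for j
      proof -
        obtain e where e: "expvec e = real_vec (v j)" by (rule expvec_surj_real_vec)
        show ?thesis using \<beta>[of "real_vec (v j)"] by (simp add: order_ideal_def S_def xpow_eq_single[OF e] e)
      qed
      then have "I \<subseteq> order_ideal y \<beta>"
        unfolding I_def by (intro ideal_gen_least is_ideal_order_ideal y) auto
      from integral_closure_subset_order_ideal[OF y ideal_power_subset_order_ideal[OF y this]] f
      have "f \<in> order_ideal y (real n * \<beta>)" by blast
      with k yk show False by (force simp: order_ideal_def)
    qed
  qed
qed

theorem integral_closure_monomial_power:
  fixes v :: "'q::finite \<Rightarrow> nat ^ 'd::finite"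
  shows "integral_closure (ideal_power (ideal_gen (range (\<lambda>j. xpow (v j) :: ('d, 'k::field) polyring))) n)
    = newton_ideal (range (\<lambda>j. real_vec (v j))) n"
  by (intro equalityI integral_closure_subset_newton_ideal newton_ideal_subset_integral_closure)

theorem proposition2p1:
  fixes v :: "'q::finite \<Rightarrow> nat ^ 'd::finite"
    and I :: "('d, 'k::field) polyring set"
    and H :: "(real ^ 'd) set"
    and b :: nat
  assumes "minimally_generates (\<lambda>j. xpow (v j)) I"
    and "hyperplane H" and "0 \<notin> H" and "\<forall>j. real_vec (v j) \<in> H"
    and "b \<ge> rank (exponent_matrix v)"
  shows "integral_closure (ideal_power I b) =
    ideal_mult I (integral_closure (ideal_power I (b - 1)))"
proof -
  define S where "S = range (\<lambda>j. real_vec (v j))"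
  have I: "I = ideal_gen (range (\<lambda>j. xpow (v j)))"
    using assms(1) by (simp add: minimally_generates_def)
  have cl: "integral_closure (ideal_power I n) = newton_ideal S n" for n
    unfolding I S_def by (rule integral_closure_monomial_power)
  obtain a c where H: "H = {x. a \<bullet> x = c}" using assms(2) unfolding hyperplane_def by blast
  have "c \<noteq> 0" using assms(3) by (auto simp: H)
  moreover have SH: "S \<subseteq> {x. a \<bullet> x = c}" using assms(4) by (auto simp: S_def H)
  ultimately have dim: "aff_dim S + 1 = int (dim S)" by (intro aff_dim_eq_dim_off_origin)
  have "columns (exponent_matrix v) = S"
    by (auto simp: columns_def column_def exponent_matrix_def S_def real_vec_def)
  then have b: "dim S \<le> b" using assms(5) by (simp add: column_rank_def)
  have "real_vec (v undefined) \<in> S" by (simp add: S_def)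
  moreover from this have "real_vec (v undefined) \<noteq> 0" using SH \<open>c \<noteq> 0\<close> by auto
  ultimately have "\<not> S \<subseteq> {0}" by blast
  then have b1: "b \<ge> 1" using b dim_eq_0[of S] by linarith
  have bS: "aff_dim S + 1 \<le> int b" using dim b by simp
  show ?thesis
    unfolding cl
  proof
    show "newton_ideal S b \<subseteq> ideal_mult I (newton_ideal S (b - 1))"
    proof
      fix f :: "('d, 'k) polyring" assume f: "f \<in> newton_ideal S b"
      have "Poly_Mapping.single k (Poly_Mapping.lookup f k) \<in> ideal_mult I (newton_ideal S (b - 1))"
        if k: "k \<in> Poly_Mapping.keys f" for k
      proof -
        have "expvec k \<in> newton_dilate S b" using f k by (simp add: newton_ideal_def)
        then obtain j e w where e: "expvec e = real_vec (v j)" and u: "k = e + w"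
          and w: "expvec w \<in> newton_dilate S (b - 1)"
          using exponent_peel[of v b k] bS b1 unfolding S_def by metis
        have "xpow (v j) \<in> I"
          unfolding I by (rule subsetD[OF ideal_gen_superset]) simp
        moreover have "Poly_Mapping.single w (Poly_Mapping.lookup f k) \<in> newton_ideal S (b - 1)"
          using w by (simp add: newton_ideal_def)
        ultimately have "xpow (v j) * Poly_Mapping.single w (Poly_Mapping.lookup f k) \<in> ideal_mult I (newton_ideal S (b - 1))"
          by (rule ideal_mult_memI)
        then show ?thesis by (simp add: xpow_eq_single[OF e] mult_single u)
      qed
      then have "(\<Sum>k\<in>Poly_Mapping.keys f. Poly_Mapping.single k (Poly_Mapping.lookup f k))
          \<in> ideal_mult I (newton_ideal S (b - 1))"
        by (rule is_ideal_sum[OF is_ideal_ideal_mult])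
      then show "f \<in> ideal_mult I (newton_ideal S (b - 1))"
        unfolding poly_mapping_eq_sum_single[symmetric] .
    qed
    show "ideal_mult I (newton_ideal S (b - 1)) \<subseteq> newton_ideal S b"
    proof (rule ideal_mult_least[OF is_ideal_newton_ideal])
      fix g h :: "('d, 'k) polyring"
      assume "g \<in> I" and h: "h \<in> newton_ideal S (b - 1)"
      have "I \<subseteq> newton_ideal S 1"
        unfolding I by (intro ideal_gen_least is_ideal_newton_ideal) (auto simp: S_def simp del: One_nat_def intro!: xpow_in_newton_ideal)
      with \<open>g \<in> I\<close> have "g \<in> newton_ideal S 1" by blast
      from newton_ideal_mult[OF this h] b1 show "g * h \<in> newton_ideal S b" by simp
    qed
  qed
qed

end
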